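(* Let $(A,\mu,\alpha,\beta)$ be a BiHom-alternative algebra and let $I$ be a two-sided BiHom-ideal of $(A,\mu,\alpha,\beta)$. Then $(A/I,\overline{\mu},\overline{\alpha},\overline{\beta})$ is a BiHom-alternative algebra, where $\overline{\mu}(\overline{x},\overline{y})=\overline{\mu(x,y)}$, $\overline{\alpha}(\overline{x})=\overline{\alpha(x)}$ and $\overline{\beta}(\overline{x})=\overline{\beta(x)}$ for all $\overline{x},\overline{y}\in A/I$.
   Context: $\mathbb{K}$ is an algebraically closed field of characteristic $0$; all vector spaces and (multi)linear maps are over $\mathbb{K}$. A BiHom-algebra $(A,\mu,\alpha,\beta)$ is a vector space $A$ with a bilinear map $\mu:A\times A\to A$ and linear maps $\alpha,\beta:A\to A$ with $\alpha\beta=\beta\alpha$. It is multiplicative if $\alpha(\mu(x,y))=\mu(\alpha(x),\alpha(y))$ and $\beta(\mu(x,y))=\mu(\beta(x),\beta(y))$ for all $x,y\in A$. Its BiHom-associator is $as_{\alpha,\beta}(x,y,z)=\mu(\mu(x,y),\beta(z))-\mu(\alpha(x),\mu(y,z))$. A BiHom-alternative algebra is a multiplicative BiHom-algebra satisfying, for all $x,y,z\in A$, $as_{\alpha,\beta}(\beta(x),\alpha(y),z)+as_{\alpha,\beta}(\beta(y),\alpha(x),z)=0$ and $as_{\alpha,\beta}(x,\beta(y),\alpha(z))+as_{\alpha,\beta}(x,\beta(z),\alpha(y))=0$. A BiHom-subalgebra of $(A,\mu,\alpha,\beta)$ is a linear subspace $H$ with $\mu(x,y),\alpha(x),\beta(x)\in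 H$ for all $x,y\in H$. If moreover $\mu(a,b)\in H$ and $\mu(b,a)\in H$ for all $(a,b)\in A\times H$, then $H$ is called a two-sided BiHom-ideal. *)

theory Defs
  imports "HOL-Algebra.QuotRing" "HOL-Algebra.Algebraic_Closure"
begin

locale base_field = algebraically_closed K for K (structure) +
  assumes char_zero: "(n::nat) > 0 \<Longrightarrow> [n] \<cdot> \<one> \<noteq> \<zero>"

text \<open>
  The product \<open>\<mu>\<close> of a BiHom-algebra is the field \<^const>\<open>monoid.mult\<close> inherited from the
  library record of modules. The inherited field \<^const>\<open>one\<close> is left unconstrained:
  BiHom-algebras need not be unital.
\<close>

record ('k, 'a) bihom = "('k, 'a) module" +
  twist_alpha :: "'a \<Rightarrow> 'a" (\<open>\<alpha>\<index>\<close>)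
  twist_beta :: "'a \<Rightarrow> 'a" (\<open>\<beta>\<index>\<close>)

definition linear_map ::
  "('k, 'r) ring_scheme \<Rightarrow> ('k, 'a, 'm) module_scheme \<Rightarrow> ('k, 'b, 'n) module_scheme
    \<Rightarrow> ('a \<Rightarrow> 'b) \<Rightarrow> bool"
  where "linear_map K V W f \<longleftrightarrow>
    f \<in> carrier V \<rightarrow> carrier W \<and>
    (\<forall>x\<in>carrier V. \<forall>y\<in>carrier V. f (x \<oplus>\<^bsub>V\<^esub> y) = f x \<oplus>\<^bsub>W\<^esub> f y) \<and>
    (\<forall>c\<in>carrier K. \<forall>x\<in>carrier V. f (c \<odot>\<^bsub>V\<^esub> x) = c \<odot>\<^bsub>W\<^esub> f x)"

locale bihom_algebra = field K + module K A
  for K :: "('k, 'r) ring_scheme" (structure) and A :: "('k, 'a, 'm) bihom_scheme" (structure) +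
  assumes mult_linear_left: "y \<in> carrier A \<Longrightarrow> linear_map K A A (\<lambda>x. x \<otimes>\<^bsub>A\<^esub> y)"
    and mult_linear_right: "x \<in> carrier A \<Longrightarrow> linear_map K A A (\<lambda>y. x \<otimes>\<^bsub>A\<^esub> y)"
    and alpha_linear: "linear_map K A A \<alpha>\<^bsub>A\<^esub>"
    and beta_linear: "linear_map K A A \<beta>\<^bsub>A\<^esub>"
    and alpha_beta_commute: "x \<in> carrier A \<Longrightarrow> \<alpha>\<^bsub>A\<^esub> (\<beta>\<^bsub>A\<^esub> x) = \<beta>\<^bsub>A\<^esub> (\<alpha>\<^bsub>A\<^esub> x)"

locale multiplicative_bihom_algebra = bihom_algebra +
  assumes alpha_mult:
      "\<lbrakk>x \<in> carrier A; y \<in> carrier A\<rbrakk> \<Longrightarrow>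
        \<alpha>\<^bsub>A\<^esub> (x \<otimes>\<^bsub>A\<^esub> y) = \<alpha>\<^bsub>A\<^esub> x \<otimes>\<^bsub>A\<^esub> \<alpha>\<^bsub>A\<^esub> y"
    and beta_mult:
      "\<lbrakk>x \<in> carrier A; y \<in> carrier A\<rbrakk> \<Longrightarrow>
        \<beta>\<^bsub>A\<^esub> (x \<otimes>\<^bsub>A\<^esub> y) = \<beta>\<^bsub>A\<^esub> x \<otimes>\<^bsub>A\<^esub> \<beta>\<^bsub>A\<^esub> y"

definition bihom_associator :: "('k, 'a, 'm) bihom_scheme \<Rightarrow> 'a \<Rightarrow> 'a \<Rightarrow> 'a \<Rightarrow> 'a"
  where "bihom_associator A x y z =
    ((x \<otimes>\<^bsub>A\<^esub> y) \<otimes>\<^bsub>A\<^esub> \<beta>\<^bsub>A\<^esub> z) \<ominus>\<^bsub>A\<^esub> (\<alpha>\<^bsub>A\<^esub> x \<otimes>\<^bsub>A\<^esub> (y \<otimes>\<^bsub>A\<^esub> z))"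

locale bihom_alternative_algebra = multiplicative_bihom_algebra +
  assumes left_alternative:
      "\<lbrakk>x \<in> carrier A; y \<in> carrier A; z \<in> carrier A\<rbrakk> \<Longrightarrow>
        bihom_associator A (\<beta>\<^bsub>A\<^esub> x) (\<alpha>\<^bsub>A\<^esub> y) z
          \<oplus>\<^bsub>A\<^esub> bihom_associator A (\<beta>\<^bsub>A\<^esub> y) (\<alpha>\<^bsub>A\<^esub> x) z = \<zero>\<^bsub>A\<^esub>"
    and right_alternative:
      "\<lbrakk>x \<in> carrier A; y \<in> carrier A; z \<in> carrier A\<rbrakk> \<Longrightarrow>
        bihom_associator A x (\<beta>\<^bsub>A\<^esub> y) (\<alpha>\<^bsub>A\<^esub> z)
          \<oplus>\<^bsub>A\<^esub> bihom_associator A x (\<beta>\<^bsub>A\<^esub> z) (\<alpha>\<^bsub>A\<^esub> y) = \<zero>\<^bsub>A\<^esub>"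

locale bihom_subalgebra = submodule H K A
  for H and K :: "('k, 'r) ring_scheme" (structure) and A :: "('k, 'a, 'm) bihom_scheme" (structure) +
  assumes mult_mem: "\<lbrakk>x \<in> H; y \<in> H\<rbrakk> \<Longrightarrow> x \<otimes>\<^bsub>A\<^esub> y \<in> H"
    and alpha_mem: "x \<in> H \<Longrightarrow> \<alpha>\<^bsub>A\<^esub> x \<in> H"
    and beta_mem: "x \<in> H \<Longrightarrow> \<beta>\<^bsub>A\<^esub> x \<in> H"

locale two_sided_bihom_ideal = bihom_subalgebra +
  assumes left_mult_mem: "\<lbrakk>a \<in> carrier A; b \<in> H\<rbrakk> \<Longrightarrow> a \<otimes>\<^bsub>A\<^esub> b \<in> H"
    and right_mult_mem: "\<lbrakk>a \<in> carrier A; b \<in> H\<rbrakk> \<Longrightarrow> b \<otimes>\<^bsub>A\<^esub> a \<in> H"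

text \<open>
  The underlying set of \<open>A/I\<close> consists of the additive cosets \<open>I +> x\<close>. As for the product in
  the library's quotient ring \<^const>\<open>FactRing\<close>, the induced product, scalar multiplication and twists
  take the union of the cosets of all results on representatives; this is a single coset
  exactly when the operation is well defined. The field \<^const>\<open>one\<close> is again only a filler.
\<close>

definition bihom_quotient ::
  "('k, 'a, 'm) bihom_scheme \<Rightarrow> 'a set \<Rightarrow> ('k, 'a set) bihom"
  where "bihom_quotient A I =
    \<lparr>carrier = a_rcosets\<^bsub>A\<^esub> I,
     monoid.mult = rcoset_mult A I,
     one = I +>\<^bsub>A\<^esub> \<one>\<^bsub>A\<^esub>,
     zero = I,
     add = set_add A,
     smult = (\<lambda>c S. \<Union>x\<in>S. I +>\<^bsub>A\<^esub> (c \<odot>\<^bsub>A\<^esub> x)),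
     twist_alpha = (\<lambda>S. \<Union>x\<in>S. I +>\<^bsub>A\<^esub> \<alpha>\<^bsub>A\<^esub> x),
     twist_beta = (\<lambda>S. \<Union>x\<in>S. I +>\<^bsub>A\<^esub> \<beta>\<^bsub>A\<^esub> x)\<rparr>"

end

theory Submission
  imports Defs
begin

text \<open>
  Right multiplications, left multiplications, scalar multiplications and twists are all additive
  maps preserving the ideal, so each of them descends to the cosets; a product on cosets is
  obtained by descending in one argument at a time. Thus the projection \<open>x \<mapsto> I +> x\<close> is
  surjective and commutes with all operations, and every identity of \<open>A\<close> passes to its image.
\<close>

text \<open>If \<open>x' = h \<oplus> x\<close> with \<open>h \<in> H\<close>, then
  \<open>f x' = f h \<oplus> f x\<close> differs from \<open>f x\<close> by an element of
  \<open>H\<close>, so all cosets in the union coincide. The union is nonempty because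
  \<open>x \<in> H +> x\<close>.\<close>

lemma (in abelian_subgroup) UN_a_rcos_additive:
  assumes "f \<in> carrier G \<rightarrow> carrier G"
    and "\<And>x y. \<lbrakk>x \<in> carrier G; y \<in> carrier G\<rbrakk> \<Longrightarrow> f (x \<oplus> y) = f x \<oplus> f y"
    and "\<And>h. h \<in> H \<Longrightarrow> f h \<in> H"
    and "x \<in> carrier G"
  shows "(\<Union>x'\<in>H +> x. H +> f x') = H +> f x"
proof -
  have "H +> f x' = H +> f x" if x': "x' \<in> H +> x" for x'
  proof -
    obtain h where h: "h \<in> H" "x' = h \<oplus> x"
      using x' by (auto simp: a_r_coset_def')
    then have "f x' \<in> H +> f x"
      using assms by (auto simp: a_r_coset_def')
    then show ?thesis
      using a_repr_independence'[of "f x'" "f x"] assms(1,4) by auto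
  qed
  moreover have "x \<in> H +> x"
    using assms(4) by (rule a_rcos_self)
  ultimately show ?thesis by blast
qed

lemma linear_mapD:
  assumes "linear_map K V W f"
  shows "f \<in> carrier V \<rightarrow> carrier W"
    and "\<And>x y. \<lbrakk>x \<in> carrier V; y \<in> carrier V\<rbrakk> \<Longrightarrow> f (x \<oplus>\<^bsub>V\<^esub> y) = f x \<oplus>\<^bsub>W\<^esub> f y"
    and "\<And>c x. \<lbrakk>c \<in> carrier K; x \<in> carrier V\<rbrakk> \<Longrightarrow> f (c \<odot>\<^bsub>V\<^esub> x) = c \<odot>\<^bsub>W\<^esub> f x"
  using assms by (auto simp: linear_map_def)

context bihom_algebra
begin

lemma alpha_closed [simp]: "x \<in> carrier A \<Longrightarrow> \<alpha>\<^bsub>A\<^esub> x \<in> carrier A"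
  using linear_mapD(1)[OF alpha_linear] by auto

lemma beta_closed [simp]: "x \<in> carrier A \<Longrightarrow> \<beta>\<^bsub>A\<^esub> x \<in> carrier A"
  using linear_mapD(1)[OF beta_linear] by auto

lemma product_closed [simp]: "\<lbrakk>x \<in> carrier A; y \<in> carrier A\<rbrakk> \<Longrightarrow> x \<otimes>\<^bsub>A\<^esub> y \<in> carrier A"
  using linear_mapD(1)[OF mult_linear_left] by auto

lemma bihom_associator_closed [simp]:
  "\<lbrakk>x \<in> carrier A; y \<in> carrier A; z \<in> carrier A\<rbrakk> \<Longrightarrow> bihom_associator A x y z \<in> carrier A"
  by (simp add: bihom_associator_def)

end

text \<open>Only the linear structure is assumed of \<open>A\<close> here; multiplicativity and
  alternativity enter later as hypotheses of the lemmas that transport them.\<close>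

locale bihom_algebra_ideal =
  bihom_algebra K A + J: two_sided_bihom_ideal I K A
  for K :: "('k, 'r) ring_scheme" (structure)
    and A :: "('k, 'a, 'm) bihom_scheme" (structure)
    and I :: "'a set"
begin

abbreviation quotient :: "('k, 'a set) bihom"
  where "quotient \<equiv> bihom_quotient A I"

text \<open>Addition is commutative, so \<open>I\<close> is normal in the additive group and the
  calculus of additive cosets applies.\<close>

sublocale abelian_subgroup I A
  by (intro abelian_subgroupI3 additive_subgroup.intro J.subgroup_axioms M.abelian_group_axioms)

text \<open>Supplies representatives: unfolding it turns a statement about arbitrary elements of the
  quotient into one about cosets \<open>I +> x\<close>, which the simp rules below evaluate in
  \<open>A\<close>.\<close>

lemma carrier_quotient: "carrier quotient = (\<lambda>x. I +>\<^bsub>A\<^esub> x) ` carrier A"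
  by (auto simp: bihom_quotient_def A_RCOSETS_def')

lemma a_rcos_mem_quotient [simp]: "x \<in> carrier A \<Longrightarrow> I +>\<^bsub>A\<^esub> x \<in> carrier quotient"
  by (simp add: carrier_quotient)

lemma quotient_add [simp]:
  "\<lbrakk>x \<in> carrier A; y \<in> carrier A\<rbrakk> \<Longrightarrow>
    (I +>\<^bsub>A\<^esub> x) \<oplus>\<^bsub>quotient\<^esub> (I +>\<^bsub>A\<^esub> y) = I +>\<^bsub>A\<^esub> (x \<oplus>\<^bsub>A\<^esub> y)"
  by (simp add: bihom_quotient_def a_rcos_sum)

text \<open>Puts the zero \<open>I\<close> into the form of a coset with a representative, so that
  the rules for cosets apply to it as well.\<close>

lemma quotient_zero: "\<zero>\<^bsub>quotient\<^esub> = I +>\<^bsub>A\<^esub> \<zero>\<^bsub>A\<^esub>"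
  by (simp add: bihom_quotient_def a_rcos_const)

lemma quotient_smult [simp]:
  assumes "c \<in> carrier K" "x \<in> carrier A"
  shows "c \<odot>\<^bsub>quotient\<^esub> (I +>\<^bsub>A\<^esub> x) = I +>\<^bsub>A\<^esub> (c \<odot>\<^bsub>A\<^esub> x)"
  using UN_a_rcos_additive[of "\<lambda>x. c \<odot>\<^bsub>A\<^esub> x" x] assms
  by (simp add: bihom_quotient_def smult_r_distr)

lemma quotient_alpha [simp]:
  assumes "x \<in> carrier A"
  shows "\<alpha>\<^bsub>quotient\<^esub> (I +>\<^bsub>A\<^esub> x) = I +>\<^bsub>A\<^esub> \<alpha>\<^bsub>A\<^esub> x"
  using UN_a_rcos_additive[of "\<alpha>\<^bsub>A\<^esub>" x] assms linear_mapD[OF alpha_linear] J.alpha_mem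
  by (simp add: bihom_quotient_def)

lemma quotient_beta [simp]:
  assumes "x \<in> carrier A"
  shows "\<beta>\<^bsub>quotient\<^esub> (I +>\<^bsub>A\<^esub> x) = I +>\<^bsub>A\<^esub> \<beta>\<^bsub>A\<^esub> x"
  using UN_a_rcos_additive[of "\<beta>\<^bsub>A\<^esub>" x] assms linear_mapD[OF beta_linear] J.beta_mem
  by (simp add: bihom_quotient_def)

lemma quotient_mult [simp]:
  assumes "x \<in> carrier A" "y \<in> carrier A"
  shows "(I +>\<^bsub>A\<^esub> x) \<otimes>\<^bsub>quotient\<^esub> (I +>\<^bsub>A\<^esub> y) = I +>\<^bsub>A\<^esub> (x \<otimes>\<^bsub>A\<^esub> y)"
proof -
  \<comment> \<open>\<open>rcoset_mult\<close> is a double union. For fixed \<open>a\<close>, left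
    multiplication by \<open>a\<close> is additive and preserves \<open>I\<close>, so the inner
    union collapses.\<close>
  have "(\<Union>b\<in>I +>\<^bsub>A\<^esub> y. I +>\<^bsub>A\<^esub> (a \<otimes>\<^bsub>A\<^esub> b)) = I +>\<^bsub>A\<^esub> (a \<otimes>\<^bsub>A\<^esub> y)"
    if "a \<in> carrier A" for a
    using UN_a_rcos_additive linear_mapD[OF mult_linear_right[OF that]] J.left_mult_mem that assms
    by simp
  \<comment> \<open>The remaining outer union collapses in the same way, now by right multiplication
    by \<open>y\<close>.\<close>
  moreover have "(\<Union>a\<in>I +>\<^bsub>A\<^esub> x. I +>\<^bsub>A\<^esub> (a \<otimes>\<^bsub>A\<^esub> y)) = I +>\<^bsub>A\<^esub> (x \<otimes>\<^bsub>A\<^esub> y)"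
    using UN_a_rcos_additive[of "\<lambda>a. a \<otimes>\<^bsub>A\<^esub> y" x] linear_mapD[OF mult_linear_left[OF assms(2)]]
      J.right_mult_mem assms
    by simp
  \<comment> \<open>The inner collapse needs \<open>a \<in> carrier A\<close>, which holds for every
    \<open>a\<close> in the coset of \<open>x\<close>.\<close>
  ultimately show ?thesis
    using a_elemrcos_carrier[OF assms(1)]
    by (simp add: bihom_quotient_def rcoset_mult_def)
qed

lemma abelian_group_quotient: "abelian_group quotient"
proof (rule abelian_groupI)
  fix S assume "S \<in> carrier quotient"
  then obtain x where "x \<in> carrier A" "S = I +>\<^bsub>A\<^esub> x"
    by (auto simp: carrier_quotient)
  \<comment> \<open>The only group axiom that asks for a witness: the coset of
    \<open>\<ominus> x\<close>.\<close>
  then show "\<exists>T\<in>carrier quotient. T \<oplus>\<^bsub>quotient\<^esub> S = \<zero>\<^bsub>quotient\<^esub>"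
    by (intro bexI[of _ "I +>\<^bsub>A\<^esub> (\<ominus>\<^bsub>A\<^esub> x)"]) (simp_all add: quotient_zero M.l_neg)
qed (auto simp: carrier_quotient quotient_zero M.a_ac)

lemma module_quotient: "module K quotient"
  by (rule moduleI)
    (auto simp: carrier_quotient abelian_group_quotient is_cring smult_l_distr smult_r_distr
      smult_assoc1)

text \<open>Subtraction is not a field of the record but is derived from addition, so its value on
  cosets comes from uniqueness of additive inverses. The associator needs it.\<close>

lemma quotient_minus [simp]:
  assumes "x \<in> carrier A" "y \<in> carrier A"
  shows "(I +>\<^bsub>A\<^esub> x) \<ominus>\<^bsub>quotient\<^esub> (I +>\<^bsub>A\<^esub> y) = I +>\<^bsub>A\<^esub> (x \<ominus>\<^bsub>A\<^esub> y)"
proof -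
  interpret Q: abelian_group quotient
    by (rule abelian_group_quotient)
  have "\<ominus>\<^bsub>quotient\<^esub> (I +>\<^bsub>A\<^esub> y) = I +>\<^bsub>A\<^esub> (\<ominus>\<^bsub>A\<^esub> y)"
    using assms by (intro Q.minus_equality) (simp_all add: quotient_zero M.l_neg)
  then show ?thesis
    using assms by (simp add: a_minus_def)
qed

lemma bihom_associator_quotient [simp]:
  "\<lbrakk>x \<in> carrier A; y \<in> carrier A; z \<in> carrier A\<rbrakk> \<Longrightarrow>
    bihom_associator quotient (I +>\<^bsub>A\<^esub> x) (I +>\<^bsub>A\<^esub> y) (I +>\<^bsub>A\<^esub> z)
      = I +>\<^bsub>A\<^esub> bihom_associator A x y z"
  by (simp add: bihom_associator_def)

lemma bihom_algebra_quotient: "bihom_algebra K quotient"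
proof (intro bihom_algebra.intro bihom_algebra_axioms.intro module_quotient field_axioms)
  note D = linear_mapD(2,3)
  show "linear_map K quotient quotient (\<lambda>x. x \<otimes>\<^bsub>quotient\<^esub> y)" if "y \<in> carrier quotient" for y
    using that
    by (auto simp: linear_map_def carrier_quotient D[OF mult_linear_left])
  show "linear_map K quotient quotient (\<lambda>y. x \<otimes>\<^bsub>quotient\<^esub> y)" if "x \<in> carrier quotient" for x
    using that
    by (auto simp: linear_map_def carrier_quotient D[OF mult_linear_right])
  show "linear_map K quotient quotient \<alpha>\<^bsub>quotient\<^esub>"
    by (auto simp: linear_map_def carrier_quotient D[OF alpha_linear])
  show "linear_map K quotient quotient \<beta>\<^bsub>quotient\<^esub>"
    by (auto simp: linear_map_def carrier_quotient D[OF beta_linear])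
  show "\<alpha>\<^bsub>quotient\<^esub> (\<beta>\<^bsub>quotient\<^esub> x) = \<beta>\<^bsub>quotient\<^esub> (\<alpha>\<^bsub>quotient\<^esub> x)" if "x \<in> carrier quotient" for x
    using that by (auto simp: carrier_quotient alpha_beta_commute)
qed

lemma multiplicative_bihom_algebra_quotient:
  assumes "multiplicative_bihom_algebra K A"
  shows "multiplicative_bihom_algebra K quotient"
proof -
  interpret multiplicative_bihom_algebra K A by fact
  show ?thesis
    by (intro multiplicative_bihom_algebra.intro multiplicative_bihom_algebra_axioms.intro
        bihom_algebra_quotient)
      (auto simp: carrier_quotient alpha_mult beta_mult)
qed

lemma bihom_alternative_algebra_quotient:
  assumes "bihom_alternative_algebra K A"
  shows "bihom_alternative_algebra K quotient"
proof -
  interpret bihom_alternative_algebra K A by fact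
  show ?thesis
    by (intro bihom_alternative_algebra.intro bihom_alternative_algebra_axioms.intro
        multiplicative_bihom_algebra_quotient multiplicative_bihom_algebra_axioms)
      \<comment> \<open>On representatives each alternativity sum is the coset of the corresponding
        sum in \<open>A\<close>, that is, the coset of zero.\<close>
      (auto simp: carrier_quotient quotient_zero left_alternative right_alternative)
qed

end

theorem proposition3p1:
  fixes K :: "('k, 'r) ring_scheme"
    and A :: "('k, 'a, 'm) bihom_scheme"
    and I :: "'a set"
  assumes "base_field K"
    and "bihom_alternative_algebra K A"
    and "two_sided_bihom_ideal I K A"
  shows "bihom_alternative_algebra K (bihom_quotient A I)
    \<and> (\<forall>x\<in>carrier A. \<forall>y\<in>carrier A.
          (I +>\<^bsub>A\<^esub> x) \<otimes>\<^bsub>bihom_quotient A I\<^esub> (I +>\<^bsub>A\<^esub> y) = I +>\<^bsub>A\<^esub> (x \<otimes>\<^bsub>A\<^esub> y))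
    \<and> (\<forall>x\<in>carrier A. \<alpha>\<^bsub>bihom_quotient A I\<^esub> (I +>\<^bsub>A\<^esub> x) = I +>\<^bsub>A\<^esub> \<alpha>\<^bsub>A\<^esub> x)
    \<and> (\<forall>x\<in>carrier A. \<beta>\<^bsub>bihom_quotient A I\<^esub> (I +>\<^bsub>A\<^esub> x) = I +>\<^bsub>A\<^esub> \<beta>\<^bsub>A\<^esub> x)"
proof -
  interpret bihom_alternative_algebra K A by fact
  interpret bihom_algebra_ideal K A I
    by (intro bihom_algebra_ideal.intro bihom_algebra_axioms assms(3))
  show ?thesis
    \<comment> \<open>The formulas on representatives are the simp rules
      \<open>quotient_mult\<close>, \<open>quotient_alpha\<close> and \<open>quotient_beta\<close>
      of the interpreted locale.\<close>
    using bihom_alternative_algebra_quotient[OF assms(2)] by simp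
qed

end
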